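(* Let $1<p<\infty$ and let $Q_0\subset\mathbb{R}^n$ be a cube. The space $JN^d_p(Q_0)$ is complete with respect to the seminorm $\|\cdot\|_{JN^d_p(Q_0)}$; that is, for every sequence $(f_j)_{j\in\mathbb{N}}$ in $JN^d_p(Q_0)$ that is Cauchy with respect to $\|\cdot\|_{JN^d_p(Q_0)}$ there exists $f\in JN^d_p(Q_0)$ such that $\|f-f_j\|_{JN^d_p(Q_0)}\to0$ as $j\to\infty$.
   Context: $|A|$ denotes Lebesgue measure and $f_A=\frac1{|A|}\int_A f\,dx$ the integral average. A cube in $\mathbb{R}^n$ is a closed bounded cube $[a_1,b_1]\times\dots\times[a_n,b_n]$ with sides parallel to the coordinate axes and $b_1-a_1=\dots=b_n-a_n>0$. Dyadic subcubes: for a cube $Q_0$, $\mathcal{D}(Q_0)=\bigcup_{j=0}^\infty \mathcal{D}_j(Q_0)$, where $\mathcal{D}_j(Q_0)$ consists of the $2^{jn}$ closed cubes of side length $2^{-j}l(Q_0)$ ($l(Q_0)$ being the side length of $Q_0$), with pairwise disjoint interiors, obtained by dividing each side of $Q_0$ into $2^j$ equal parts. Elements of $\mathcal{D}(Q_0)$ are the dyadic subcubes of $Q_0$. Collections of dyadic cubes are called pairwise disjoint if their interiors are pairwise disjoint. Dyadic John--Nirenberg space: for $1<p<\infty$, a function $f\in L^1(Q_0)$ belongs to $JN^d_p(Q_0)$ if \[ \|f\|_{JN^d_{p}(Q_0)}^p=\sup\sum_{i}|Q_i|\Bigl(\frac1{|Q_i|}\int_{Q_i}|f-f_{Q_i}|\,dx\Bigr)^p<\infty,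 \] where the supremum is taken over countable collections $\{Q_i\}$ of pairwise disjoint dyadic subcubes of $Q_0$. *)

theory Defs
  imports "HOL-Analysis.Analysis"
begin

definition cube :: "real ^ 'n \<Rightarrow> real \<Rightarrow> (real ^ 'n) set" where
  "cube a l = cbox a (\<chi> i. a $ i + l)"

definition is_cube :: "(real ^ 'n) set \<Rightarrow> bool" where
  "is_cube Q \<longleftrightarrow> (\<exists>a l. l > 0 \<and> Q = cube a l)"

text \<open>The corner \<open>a\<close> and the side length \<open>l\<close> are uniquely determined by the cube, so the
  existential quantifiers over them only recover these data from the set \<open>Q0\<close>.\<close>

definition dyadic_gen :: "nat \<Rightarrow> (real ^ 'n) set \<Rightarrow> (real ^ 'n) set set" where
  "dyadic_gen j Q0 =
     {Q. \<exists>a l. l > 0 \<and> Q0 = cube a l \<and>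
         (\<exists>k :: 'n \<Rightarrow> nat. (\<forall>i. k i < 2 ^ j) \<and>
            Q = cube (\<chi> i. a $ i + real (k i) * (l / 2 ^ j)) (l / 2 ^ j))}"

definition dyadic :: "(real ^ 'n) set \<Rightarrow> (real ^ 'n) set set" where
  "dyadic Q0 = (\<Union>j. dyadic_gen j Q0)"

definition average :: "(real ^ 'n) set \<Rightarrow> (real ^ 'n \<Rightarrow> real) \<Rightarrow> real" where
  "average A f = 1 / measure lebesgue A * (LINT x:A|lebesgue. f x)"

text \<open>A collection of dyadic cubes is a set of cubes rather than an indexed family: cubes have
  nonempty interior, so a family with pairwise disjoint interiors has no repetitions.\<close>

definition dyadic_collections :: "(real ^ 'n) set \<Rightarrow> (real ^ 'n) set set set" where
  "dyadic_collections Q0 =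
     {C. C \<subseteq> dyadic Q0 \<and> countable C \<and>
         pairwise (\<lambda>Q R. interior Q \<inter> interior R = {}) C}"

definition JNd_sup :: "real \<Rightarrow> (real ^ 'n) set \<Rightarrow> (real ^ 'n \<Rightarrow> real) \<Rightarrow> ennreal" where
  "JNd_sup p Q0 f =
     (SUP C \<in> dyadic_collections Q0.
        \<Sum>\<^sub>\<infinity>Q\<in>C. ennreal (measure lebesgue Q * average Q (\<lambda>x. \<bar>f x - average Q f\<bar>) powr p))"

text \<open>The seminorm is the \<open>p\<close>-th root of the supremum, with values in \<^typ>\<open>ennreal\<close>, so that it
  is infinite (and not a default value) on integrable functions outside the space.\<close>

definition JNd_norm :: "real \<Rightarrow> (real ^ 'n) set \<Rightarrow> (real ^ 'n \<Rightarrow> real) \<Rightarrow> ennreal" where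
  "JNd_norm p Q0 f =
     (if JNd_sup p Q0 f = \<infinity> then \<infinity> else ennreal (enn2real (JNd_sup p Q0 f) powr (1 / p)))"

text \<open>Functions on \<open>Q0\<close> are represented by total functions, of which only the values on \<open>Q0\<close>
  matter.\<close>

definition JNd :: "real \<Rightarrow> (real ^ 'n) set \<Rightarrow> (real ^ 'n \<Rightarrow> real) set" where
  "JNd p Q0 = {f. set_integrable lebesgue Q0 f \<and> JNd_norm p Q0 f < \<infinity>}"

end

theory Submission
  imports Defs
begin

text \<open>The single cube \<open>Q0\<close> is an admissible collection, so after subtracting their averages over
  \<open>Q0\<close> the \<open>f j\<close> form a Cauchy sequence in \<open>L\<^sup>1(Q0)\<close>; let \<open>g\<close> be the limit. On each fixed dyadic
  subcube the mean oscillation is continuous in \<open>L\<^sup>1\<close> and blind to constants, so a bound on the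
  finite sums for \<open>f i - f j\<close> passes to \<open>g - f j\<close> as \<open>i\<close> tends to infinity. Finite sums suffice,
  because the terms are nonnegative.\<close>

section \<open>Completeness of L1\<close>

text \<open>A Cauchy sequence in L1 has a subsequence converging almost everywhere. Fatou's lemma
  along that subsequence carries the Cauchy bound over to the distance of every late term from the
  pointwise limit.\<close>

lemma L1_complete:
  fixes s :: "nat \<Rightarrow> 'a \<Rightarrow> 'b::{banach, second_countable_topology}"
  assumes s [measurable]: "\<And>n. integrable M (s n)"
    and cauchy: "\<And>e. e > 0 \<Longrightarrow> \<exists>N. \<forall>i\<ge>N. \<forall>j\<ge>N. (LINT x|M. norm (s i x - s j x)) < e"
  obtains u where "integrable M u" "(\<lambda>n. LINT x|M. norm (s n x - u x)) \<longlonglongrightarrow> 0"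
proof -
  obtain r where r: "strict_mono r" and ae: "AE x in M. Cauchy (\<lambda>i. s (r i) x)"
    using cauchy_L1_AE_cauchy_subseq[OF s cauchy] by blast
  have [measurable]: "s n \<in> borel_measurable M" for n
    by (rule borel_measurable_integrable[OF s])
  define u where "u x = lim (\<lambda>i. s (r i) x)" for x
  have u [measurable]: "u \<in> borel_measurable M"
    unfolding u_def by measurable
  have lim: "AE x in M. (\<lambda>i. s (r i) x) \<longlonglongrightarrow> u x"
    using ae by eventually_elim (auto simp: u_def Cauchy_convergent_iff convergent_LIMSEQ_iff)
  \<comment> \<open>Integrability of \<open>u\<close> is still open, so distances to it are first
    measured by the nonnegative integral, which has no default value.\<close>
  have bound: "\<exists>N. \<forall>i\<ge>N. (\<integral>\<^sup>+x. norm (s i x - u x) \<partial>M) \<le> ennreal e" if e: "e > 0" for e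
  proof -
    obtain N where N: "\<And>i j. i \<ge> N \<Longrightarrow> j \<ge> N \<Longrightarrow> (LINT x|M. norm (s i x - s j x)) < e"
      using cauchy[OF e] by blast
    have "(\<integral>\<^sup>+x. norm (s i x - u x) \<partial>M) \<le> ennreal e" if i: "i \<ge> N" for i
    proof -
      \<comment> \<open>The integrand is rewritten as a limit inferior along the subsequence, the
        form that Fatou's lemma takes.\<close>
      have "AE x in M. ennreal (norm (s i x - u x)) = liminf (\<lambda>k. ennreal (norm (s i x - s (r k) x)))"
        using lim
      proof eventually_elim
        case (elim x)
        then have "(\<lambda>k. ennreal (norm (s i x - s (r k) x))) \<longlonglongrightarrow> ennreal (norm (s i x - u x))"
          by (intro tendsto_ennrealI tendsto_intros)
        then show ?case
          by (intro lim_imp_Liminf[symmetric]) auto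
      qed
      then have "(\<integral>\<^sup>+x. norm (s i x - u x) \<partial>M)
          = (\<integral>\<^sup>+x. liminf (\<lambda>k. ennreal (norm (s i x - s (r k) x))) \<partial>M)"
        by (rule nn_integral_cong_AE)
      also have "\<dots> \<le> liminf (\<lambda>k. \<integral>\<^sup>+x. ennreal (norm (s i x - s (r k) x)) \<partial>M)"
        by (rule nn_integral_liminf) measurable
      also have "\<dots> \<le> liminf (\<lambda>k::nat. ennreal e)"
      proof (intro Liminf_mono eventually_sequentiallyI)
        fix k assume "N \<le> k"
        then have "N \<le> r k"
          using seq_suble[OF r, of k] by linarith
        have "(\<integral>\<^sup>+x. ennreal (norm (s i x - s (r k) x)) \<partial>M) = ennreal (LINT x|M. norm (s i x - s (r k) x))"
          using s by (intro nn_integral_eq_integral) auto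
        then show "(\<integral>\<^sup>+x. ennreal (norm (s i x - s (r k) x)) \<partial>M) \<le> ennreal e"
          using N[OF i \<open>N \<le> r k\<close>] by (simp add: ennreal_leI)
      qed
      finally show ?thesis
        by (simp add: Liminf_const)
    qed
    then show ?thesis by blast
  qed
  have diff: "integrable M (\<lambda>x. s i x - u x)" if "(\<integral>\<^sup>+x. norm (s i x - u x) \<partial>M) \<le> ennreal e" for i e
    using that by (intro integrableI_bounded) (auto simp: le_less_trans)
  \<comment> \<open>One term at finite distance suffices: \<open>u\<close> is the difference of
    \<open>s N\<close> and \<open>s N - u\<close>, both integrable.\<close>
  obtain N where "(\<integral>\<^sup>+x. norm (s N x - u x) \<partial>M) \<le> ennreal 1"
    using bound[of 1] by auto
  then have "integrable M (\<lambda>x. s N x - (s N x - u x))"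
    by (intro Bochner_Integration.integrable_diff s diff)
  then have int: "integrable M u"
    by simp
  have "(\<lambda>n. LINT x|M. norm (s n x - u x)) \<longlonglongrightarrow> 0"
  proof (rule LIMSEQ_I)
    fix e :: real assume "0 < e"
    \<comment> \<open>Passing to the limit yields only non-strict bounds; \<open>e / 2\<close>
      restores the strict one.\<close>
    then obtain N where N: "\<And>i. i \<ge> N \<Longrightarrow> (\<integral>\<^sup>+x. norm (s i x - u x) \<partial>M) \<le> ennreal (e / 2)"
      using bound[of "e / 2"] by auto
    have "(LINT x|M. norm (s i x - u x)) \<le> e / 2" if "i \<ge> N" for i
    proof -
      have "ennreal (LINT x|M. norm (s i x - u x)) = (\<integral>\<^sup>+x. norm (s i x - u x) \<partial>M)"
        using s int by (intro nn_integral_eq_integral[symmetric]) auto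
      also have "\<dots> \<le> ennreal (e / 2)"
        by (rule N[OF that])
      finally show ?thesis
        using \<open>0 < e\<close> by (subst (asm) ennreal_le_iff) auto
    qed
    then show "\<exists>N. \<forall>n\<ge>N. norm ((LINT x|M. norm (s n x - u x)) - 0) < e"
      using \<open>0 < e\<close> by (intro exI[of _ N]) fastforce
  qed
  with int show thesis by (rule that)
qed

text \<open>Multiplication by the indicator of \<open>A\<close> turns integrals over
  \<open>A\<close> into integrals over the whole space.\<close>

lemma set_L1_complete:
  fixes s :: "nat \<Rightarrow> 'a \<Rightarrow> real"
  assumes A: "A \<in> sets M" and s: "\<And>n. set_integrable M A (s n)"
    and cauchy: "\<And>e. e > 0 \<Longrightarrow> \<exists>N. \<forall>i\<ge>N. \<forall>j\<ge>N. (LINT x:A|M. \<bar>s i x - s j x\<bar>) < e"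
  obtains u where "set_integrable M A u" "(\<lambda>n. LINT x:A|M. \<bar>s n x - u x\<bar>) \<longlonglongrightarrow> 0"
proof -
  let ?s = "\<lambda>n x. indicator A x *\<^sub>R s n x"
  have s': "integrable M (?s n)" for n
    using s by (simp add: set_integrable_def)
  have "(LINT x|M. norm (?s i x - ?s j x)) = (LINT x:A|M. \<bar>s i x - s j x\<bar>)" for i j
    unfolding set_lebesgue_integral_def
    by (intro Bochner_Integration.integral_cong) (auto simp: indicator_def)
  then have "\<exists>N. \<forall>i\<ge>N. \<forall>j\<ge>N. (LINT x|M. norm (?s i x - ?s j x)) < e" if "e > 0" for e
    using cauchy[OF that] by simp
  then obtain u where u: "integrable M u" and lim: "(\<lambda>n. LINT x|M. norm (?s n x - u x)) \<longlonglongrightarrow> 0"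
    using L1_complete[of M ?s, OF s'] by blast
  have uA: "set_integrable M A u"
    unfolding set_integrable_def by (rule integrable_mult_indicator[OF A u])
  \<comment> \<open>The limit \<open>u\<close> may be nonzero off \<open>A\<close>, so discarding
    that region gives an inequality.\<close>
  have "(LINT x:A|M. \<bar>s n x - u x\<bar>) \<le> (LINT x|M. norm (?s n x - u x))" for n
    using set_integrable_abs[OF set_integral_diff(1)[OF s[of n] uA]] s'[of n] u
    unfolding set_lebesgue_integral_def set_integrable_def
    by (intro integral_mono) (auto simp: indicator_def)
  moreover have "0 \<le> (LINT x:A|M. \<bar>s n x - u x\<bar>)" for n
    unfolding set_lebesgue_integral_def by (intro Bochner_Integration.integral_nonneg) simp
  ultimately have "(\<lambda>n. LINT x:A|M. \<bar>s n x - u x\<bar>) \<longlonglongrightarrow> 0"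
    by (intro tendsto_sandwich[OF _ _ tendsto_const lim]) auto
  with uA show thesis by (rule that)
qed


subsection \<open>Mean oscillation\<close>

text \<open>This is the base of the p-th power in \<open>JNd_sup\<close>, singled out so that it can
  be studied on one cube at a time.\<close>

definition osc :: "(real ^ 'n) set \<Rightarrow> (real ^ 'n \<Rightarrow> real) \<Rightarrow> real" where
  "osc Q u = average Q (\<lambda>x. \<bar>u x - average Q u\<bar>)"

lemma average_add:
  assumes "set_integrable lebesgue Q u" "set_integrable lebesgue Q v"
  shows "average Q (\<lambda>x. u x + v x) = average Q u + average Q v"
  using assms by (simp add: average_def add_divide_distrib)

lemma average_diff:
  assumes "set_integrable lebesgue Q u" "set_integrable lebesgue Q v"
  shows "average Q (\<lambda>x. u x - v x) = average Q u - average Q v"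
  using assms by (simp add: average_def diff_divide_distrib)

lemma average_mono:
  assumes "set_integrable lebesgue Q u" "set_integrable lebesgue Q v" "\<And>x. x \<in> Q \<Longrightarrow> u x \<le> v x"
  shows "average Q u \<le> average Q v"
  using set_integral_mono[OF assms] by (simp add: average_def divide_right_mono)

lemma average_nonneg: "(\<And>x. x \<in> Q \<Longrightarrow> 0 \<le> u x) \<Longrightarrow> 0 \<le> average Q u"
  unfolding average_def set_lebesgue_integral_def
  by (intro mult_nonneg_nonneg Bochner_Integration.integral_nonneg) (auto simp: indicator_def)

lemma osc_nonneg: "0 \<le> osc Q u"
  unfolding osc_def by (rule average_nonneg) simp

lemma set_integrable_const_lmeasurable:
  fixes c :: real
  assumes "Q \<in> lmeasurable"
  shows "set_integrable lebesgue Q (\<lambda>x. c)"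
  unfolding set_integrable_def using assms
  by (intro integrable_scaleR_left integrable_real_indicator) (auto simp: fmeasurable_def)

text \<open>Positive measure keeps the convention \<open>1 / 0 = 0\<close> out of the
  average.\<close>

lemma average_const:
  assumes "Q \<in> lmeasurable" "measure lebesgue Q > 0"
  shows "average Q (\<lambda>x. c) = c"
  using assms by (simp add: average_def set_lebesgue_integral_def)

context
  fixes Q :: "(real ^ 'n) set"
  assumes meas: "Q \<in> lmeasurable" and pos: "measure lebesgue Q > 0"
begin

private lemma set_integrable_abs_diff:
  assumes "set_integrable lebesgue Q u"
  shows "set_integrable lebesgue Q (\<lambda>x. \<bar>u x - c\<bar> :: real)"
  using assms set_integrable_const_lmeasurable[OF meas] by (intro set_integrable_abs set_integral_diff)

text \<open>The average shifts by the same constant, which cancels. This permits replacing functions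
  by normalised ones.\<close>

lemma osc_diff_const:
  assumes "set_integrable lebesgue Q u"
  shows "osc Q (\<lambda>x. u x - c) = osc Q u"
  using assms
  by (simp add: osc_def average_diff average_const[OF meas pos] set_integrable_const_lmeasurable[OF meas])

lemma osc_add_le:
  assumes u: "set_integrable lebesgue Q u" and v: "set_integrable lebesgue Q v"
  shows "osc Q (\<lambda>x. u x + v x) \<le> osc Q u + osc Q v"
proof -
  have "osc Q (\<lambda>x. u x + v x) \<le> average Q (\<lambda>x. \<bar>u x - average Q u\<bar> + \<bar>v x - average Q v\<bar>)"
    unfolding osc_def average_add[OF u v]
    by (intro average_mono set_integrable_abs_diff set_integral_add u v) auto
  also have "\<dots> = osc Q u + osc Q v"
    unfolding osc_def by (intro average_add set_integrable_abs_diff u v)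
  finally show ?thesis .
qed

text \<open>The factor 2 comes from |u - u_Q| \<le> |u| + |u_Q|, where |u_Q| is at most the average
  of |u|.\<close>

lemma osc_le_average_abs:
  assumes u: "set_integrable lebesgue Q u"
  shows "osc Q u \<le> 2 * average Q (\<lambda>x. \<bar>u x\<bar>)"
proof -
  have abs: "set_integrable lebesgue Q (\<lambda>x. \<bar>u x\<bar>)"
    by (rule set_integrable_abs[OF u])
  have "average Q u \<le> average Q (\<lambda>x. \<bar>u x\<bar>)"
    by (intro average_mono u abs) auto
  moreover have "average Q (\<lambda>x. - \<bar>u x\<bar>) \<le> average Q u"
    using set_integrable_mult_right[of "-1", OF abs] by (intro average_mono u) auto
  moreover have "average Q (\<lambda>x. - \<bar>u x\<bar>) = - average Q (\<lambda>x. \<bar>u x\<bar>)"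
    by (simp add: average_def set_integral_uminus[OF abs])
  ultimately have "\<bar>average Q u\<bar> \<le> average Q (\<lambda>x. \<bar>u x\<bar>)"
    by linarith
  moreover have "osc Q u \<le> average Q (\<lambda>x. \<bar>u x\<bar> + \<bar>average Q u\<bar>)"
    unfolding osc_def
    by (intro average_mono set_integrable_abs_diff set_integral_add u abs
        set_integrable_const_lmeasurable meas) auto
  moreover have "average Q (\<lambda>x. \<bar>u x\<bar> + \<bar>average Q u\<bar>) = average Q (\<lambda>x. \<bar>u x\<bar>) + \<bar>average Q u\<bar>"
    by (simp add: average_add[OF abs] average_const[OF meas pos] set_integrable_const_lmeasurable[OF meas])
  ultimately show ?thesis by linarith
qed

text \<open>Write u = v + (u - v), use subadditivity, and bound the oscillation of the difference by
  its L1 average; then exchange u and v. Hence oscillation is Lipschitz in L1 on a fixed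
  cube.\<close>

lemma abs_osc_diff_le:
  assumes u: "set_integrable lebesgue Q u" and v: "set_integrable lebesgue Q v"
  shows "\<bar>osc Q u - osc Q v\<bar> \<le> 2 * average Q (\<lambda>x. \<bar>u x - v x\<bar>)"
proof -
  have "osc Q u \<le> osc Q v + 2 * average Q (\<lambda>x. \<bar>u x - v x\<bar>)"
    if "set_integrable lebesgue Q u" "set_integrable lebesgue Q v" for u v
    using osc_add_le[of v "\<lambda>x. u x - v x"] osc_le_average_abs[of "\<lambda>x. u x - v x"] that by simp
  from this[OF u v] this[OF v u] show ?thesis
    by (simp add: abs_minus_commute abs_le_iff)
qed

lemma tendsto_osc:
  assumes "\<And>n. set_integrable lebesgue Q (u n)" "set_integrable lebesgue Q v"
    and "((\<lambda>n. average Q (\<lambda>x. \<bar>u n x - v x\<bar>)) \<longlongrightarrow> 0) F"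
  shows "((\<lambda>n. osc Q (u n)) \<longlongrightarrow> osc Q v) F"
proof (rule Lim_transform_bound[THEN LIM_zero_cancel])
  show "\<forall>\<^sub>F n in F. norm (osc Q (u n) - osc Q v) \<le> norm (2 * average Q (\<lambda>x. \<bar>u n x - v x\<bar>))"
    using order_trans[OF abs_osc_diff_le[OF assms(1,2)] abs_ge_self] by simp
  show "((\<lambda>n. 2 * average Q (\<lambda>x. \<bar>u n x - v x\<bar>)) \<longlongrightarrow> 0) F"
    using tendsto_mult_right_zero[OF assms(3)] by simp
qed

end

text \<open>Bounding the sum by twice the maximum takes the place of Minkowski's inequality where
  only finiteness is at stake.\<close>

lemma powr_add_le:
  fixes a b p :: real
  assumes "0 \<le> a" "0 \<le> b" "0 \<le> p"
  shows "(a + b) powr p \<le> 2 powr p * (a powr p + b powr p)"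
proof -
  have "(a + b) powr p \<le> (2 * max a b) powr p"
    using assms by (intro powr_mono2) auto
  also have "\<dots> = 2 powr p * max a b powr p"
    by (rule powr_mult)
  also have "\<dots> \<le> 2 powr p * (a powr p + b powr p)"
    by (intro mult_left_mono) (auto simp: max_def)
  finally show ?thesis .
qed


subsection \<open>Dyadic cubes and the seminorm\<close>

lemma lmeasurable_cube: "cube a l \<in> lmeasurable"
  by (simp add: cube_def)

lemma measure_cube_pos:
  assumes "l > 0"
  shows "measure lebesgue (cube a l :: (real ^ 'n) set) > 0"
  using assms by (simp add: cube_def content_cbox_cart interval_eq_empty_cart not_less prod_pos)

lemma dyadicE:
  assumes "Q \<in> dyadic Q0"
  shows "Q \<in> lmeasurable" "measure lebesgue Q > 0" "Q \<subseteq> Q0"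
proof -
  obtain j a l k where l: "l > 0" and Q0: "Q0 = cube a l" and k: "\<And>i. (k i :: nat) < 2 ^ j"
    and Q: "Q = cube (\<chi> i. a $ i + real (k i) * (l / 2 ^ j)) (l / 2 ^ j)"
    using assms unfolding dyadic_def dyadic_gen_def by auto
  show "Q \<in> lmeasurable" "measure lebesgue Q > 0"
    unfolding Q using l by (auto intro: lmeasurable_cube measure_cube_pos)
  have upper: "real (k i) * (l / 2 ^ j) + l / 2 ^ j \<le> l" for i
  proof -
    \<comment> \<open>Since k i < 2^j holds for natural numbers, even the right end of the last
      subinterval stays inside \<open>Q0\<close>.\<close>
    have "real (k i + 1) \<le> real (2 ^ j)"
      using k[of i] by (intro of_nat_mono) simp
    then have "real (k i + 1) * (l / 2 ^ j) \<le> 2 ^ j * (l / 2 ^ j)"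
      using l by (intro mult_right_mono) auto
    then show ?thesis by (simp add: field_simps)
  qed
  have lower: "0 \<le> real (k i) * (l / 2 ^ j)" for i
    using l by simp
  have "a $ i \<le> x $ i \<and> x $ i \<le> a $ i + l" if "x \<in> Q" for x i
    using that[unfolded Q cube_def mem_box_cart vec_lambda_beta, rule_format, of i] upper[of i] lower[of i]
    by linarith
  then show "Q \<subseteq> Q0"
    by (auto simp: Q0 cube_def mem_box_cart)
qed

text \<open>Generation 0 with all indices 0 has corner \<open>a\<close> and side
  \<open>l / 2 ^ 0\<close>.\<close>

lemma cube_in_dyadic:
  assumes "is_cube Q0"
  shows "Q0 \<in> dyadic Q0"
proof -
  obtain a l where "l > 0" "Q0 = cube a l"
    using assms by (auto simp: is_cube_def)
  then have "Q0 \<in> dyadic_gen 0 Q0"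
    unfolding dyadic_gen_def by (auto intro!: exI[of _ a] exI[of _ l] exI[of _ "\<lambda>_. 0"])
  then show ?thesis
    by (auto simp: dyadic_def)
qed

lemma dyadic_collections_subset:
  "C \<in> dyadic_collections Q0 \<Longrightarrow> D \<subseteq> C \<Longrightarrow> D \<in> dyadic_collections Q0"
  unfolding dyadic_collections_def by (auto intro: countable_subset pairwise_subset)

text \<open>Finite subsets of an admissible collection are admissible, and an infinite sum of
  nonnegative terms is the supremum of its finite partial sums. Limits and estimates can thus be
  handled in real finite sums.\<close>

lemma JNd_sup_le_iff:
  assumes "0 \<le> b"
  shows "JNd_sup p Q0 u \<le> ennreal b \<longleftrightarrow>
    (\<forall>F \<in> dyadic_collections Q0. finite F \<longrightarrow> (\<Sum>Q\<in>F. measure lebesgue Q * osc Q u powr p) \<le> b)"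
proof -
  have sum: "(\<Sum>Q\<in>F. ennreal (measure lebesgue Q * osc Q u powr p)) \<le> ennreal b \<longleftrightarrow>
      (\<Sum>Q\<in>F. measure lebesgue Q * osc Q u powr p) \<le> b" for F
    using assms by (subst sum_ennreal) (auto simp: ennreal_le_iff)
  show ?thesis
    unfolding JNd_sup_def osc_def[symmetric]
  proof (intro iffI ballI impI)
    fix F :: "(real ^ 'a) set set"
    assume "(SUP C\<in>dyadic_collections Q0.
      \<Sum>\<^sub>\<infinity>Q\<in>C. ennreal (measure lebesgue Q * osc Q u powr p)) \<le> ennreal b"
      and "F \<in> dyadic_collections Q0" "finite F"
    then show "(\<Sum>Q\<in>F. measure lebesgue Q * osc Q u powr p) \<le> b"
      by (auto simp: SUP_le_iff sum[symmetric] dest!: bspec)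
  next
    assume *: "\<forall>F\<in>dyadic_collections Q0. finite F \<longrightarrow> (\<Sum>Q\<in>F. measure lebesgue Q * osc Q u powr p) \<le> b"
    show "(SUP C\<in>dyadic_collections Q0.
      \<Sum>\<^sub>\<infinity>Q\<in>C. ennreal (measure lebesgue Q * osc Q u powr p)) \<le> ennreal b"
      using * dyadic_collections_subset
      by (intro SUP_least infsum_le_finite_sums nonneg_summable_on_complete)
        (auto simp: sum simp del: sum_ennreal)
  qed
qed

lemma JNd_sup_le_of_norm_le:
  assumes "p > 0" "0 \<le> b" "JNd_norm p Q0 u \<le> ennreal b"
  shows "JNd_sup p Q0 u \<le> ennreal (b powr p)"
proof -
  \<comment> \<open>A finite bound excludes the infinite branch of \<open>JNd_norm\<close>, so
    \<open>enn2real\<close> loses no information.\<close>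
  have fin: "JNd_sup p Q0 u \<noteq> \<infinity>"
    using assms(3) by (auto simp: JNd_norm_def top_unique)
  let ?r = "enn2real (JNd_sup p Q0 u)"
  have "?r powr (1 / p) \<le> b"
    using assms fin by (auto simp: JNd_norm_def ennreal_le_iff)
  then have "(?r powr (1 / p)) powr p \<le> b powr p"
    using assms by (intro powr_mono2) auto
  then have "?r \<le> b powr p"
    using assms by (simp add: powr_powr)
  then have "ennreal ?r \<le> ennreal (b powr p)"
    by (rule ennreal_leI)
  moreover have "ennreal ?r = JNd_sup p Q0 u"
    using fin by (simp add: less_top)
  ultimately show ?thesis
    by (simp only:)
qed

lemma JNd_norm_le_of_sup_le:
  assumes "p > 0" "0 \<le> b" "JNd_sup p Q0 u \<le> ennreal (b powr p)"
  shows "JNd_norm p Q0 u \<le> ennreal b"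
proof -
  have fin: "JNd_sup p Q0 u \<noteq> \<infinity>"
    using assms(3) by (auto simp: top_unique)
  have "enn2real (JNd_sup p Q0 u) \<le> b powr p"
    using enn2real_mono[OF assms(3)] by simp
  then have "enn2real (JNd_sup p Q0 u) powr (1 / p) \<le> (b powr p) powr (1 / p)"
    using assms by (intro powr_mono2) auto
  then show ?thesis
    using assms fin by (simp add: JNd_norm_def powr_powr ennreal_leI)
qed

lemma JNd_norm_finite_iff: "JNd_norm p Q0 u < \<infinity> \<longleftrightarrow> (\<exists>b\<ge>0. JNd_sup p Q0 u \<le> ennreal b)"
proof
  assume "JNd_norm p Q0 u < \<infinity>"
  then have "JNd_sup p Q0 u \<noteq> \<infinity>"
    by (auto simp: JNd_norm_def)
  then show "\<exists>b\<ge>0. JNd_sup p Q0 u \<le> ennreal b"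
    by (intro exI[of _ "enn2real (JNd_sup p Q0 u)"]) (simp add: less_top)
next
  assume "\<exists>b\<ge>0. JNd_sup p Q0 u \<le> ennreal b"
  then have "JNd_sup p Q0 u \<noteq> \<infinity>"
    by (auto simp: top_unique)
  then show "JNd_norm p Q0 u < \<infinity>"
    by (simp add: JNd_norm_def)
qed

section \<open>Stability of the space under sums, L1 limits and constants\<close>

lemma set_integrable_dyadic:
  fixes u :: "real ^ 'n \<Rightarrow> real"
  assumes "set_integrable lebesgue Q0 u" "Q \<in> dyadic Q0"
  shows "set_integrable lebesgue Q u"
  using assms dyadicE[OF assms(2)] by (intro set_integrable_subset[OF assms(1)]) auto

text \<open>Oscillation is subadditive on each cube, and the factor 2^p does not affect finiteness.
  The lemma serves to recover the limit from its difference to one term of the sequence.\<close>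

lemma JNd_add:
  assumes "0 \<le> p" "u \<in> JNd p Q0" "v \<in> JNd p Q0"
  shows "(\<lambda>x. u x + v x) \<in> JNd p Q0"
proof -
  have iu: "set_integrable lebesgue Q0 u" and iv: "set_integrable lebesgue Q0 v"
    using assms by (auto simp: JNd_def)
  obtain b c where b: "0 \<le> b" "JNd_sup p Q0 u \<le> ennreal b" and c: "0 \<le> c" "JNd_sup p Q0 v \<le> ennreal c"
    using assms unfolding JNd_def mem_Collect_eq JNd_norm_finite_iff
    by blast
  have "JNd_sup p Q0 (\<lambda>x. u x + v x) \<le> ennreal (2 powr p * (b + c))"
  proof -
    have bc: "0 \<le> 2 powr p * (b + c)"
      using b c by simp
    show ?thesis
      unfolding JNd_sup_le_iff[OF bc]
    proof (intro ballI impI)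
      fix F assume F: "F \<in> dyadic_collections Q0" "finite F"
      have "(\<Sum>Q\<in>F. measure lebesgue Q * osc Q (\<lambda>x. u x + v x) powr p)
          \<le> (\<Sum>Q\<in>F. 2 powr p * (measure lebesgue Q * osc Q u powr p + measure lebesgue Q * osc Q v powr p))"
      proof (rule sum_mono)
        fix Q assume "Q \<in> F"
        then have Q: "Q \<in> dyadic Q0"
          using F by (auto simp: dyadic_collections_def)
        have "osc Q (\<lambda>x. u x + v x) powr p \<le> (osc Q u + osc Q v) powr p"
          using Q assms(1) by (intro powr_mono2 osc_nonneg osc_add_le dyadicE[OF Q] set_integrable_dyadic[OF _ Q] iu iv)
        also have "\<dots> \<le> 2 powr p * (osc Q u powr p + osc Q v powr p)"
          by (intro powr_add_le osc_nonneg assms)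
        finally have "measure lebesgue Q * osc Q (\<lambda>x. u x + v x) powr p
            \<le> measure lebesgue Q * (2 powr p * (osc Q u powr p + osc Q v powr p))"
          by (rule mult_left_mono) simp
        then show "measure lebesgue Q * osc Q (\<lambda>x. u x + v x) powr p
            \<le> 2 powr p * (measure lebesgue Q * osc Q u powr p + measure lebesgue Q * osc Q v powr p)"
          by (simp add: algebra_simps)
      qed
      also have "\<dots> \<le> 2 powr p * (b + c)"
        unfolding sum_distrib_left[symmetric] sum.distrib
        using b c F by (intro mult_left_mono add_mono) (auto simp: JNd_sup_le_iff)
      finally show "(\<Sum>Q\<in>F. measure lebesgue Q * osc Q (\<lambda>x. u x + v x) powr p) \<le> 2 powr p * (b + c)" .
    qed
  qed
  then have "JNd_norm p Q0 (\<lambda>x. u x + v x) < \<infinity>"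
    using b c unfolding JNd_norm_finite_iff by (intro exI[of _ "2 powr p * (b + c)"]) simp
  then show ?thesis
    using iu iv by (auto simp: JNd_def)
qed

text \<open>Test the supremum with the collection \<open>{Q0}\<close>; the measure factor in the
  bound is there to cancel.\<close>

lemma osc_le_of_JNd_sup_le:
  assumes "p > 0" "0 \<le> b" "is_cube Q0" "JNd_sup p Q0 u \<le> ennreal (measure lebesgue Q0 * b powr p)"
  shows "osc Q0 u \<le> b"
proof -
  have Q0: "Q0 \<in> dyadic Q0"
    by (rule cube_in_dyadic[OF assms(3)])
  then have "{Q0} \<in> dyadic_collections Q0"
    by (auto simp: dyadic_collections_def)
  then have "measure lebesgue Q0 * osc Q0 u powr p \<le> measure lebesgue Q0 * b powr p"
    using assms by (subst (asm) JNd_sup_le_iff) (auto dest!: bspec[of _ _ "{Q0}"])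
  then have "osc Q0 u powr p \<le> b powr p"
    using dyadicE(2)[OF Q0] by simp
  then show ?thesis
    using powr_less_mono2[OF assms(1,2), of "osc Q0 u"] by (meson not_le)
qed

text \<open>Lower semicontinuity under L1 convergence: for a fixed finite collection the sum
  converges term by term, so no uniformity over cubes is required.\<close>

lemma JNd_sup_le_of_L1_limit:
  assumes "p > 0" "0 \<le> b"
    and u: "\<And>n. set_integrable lebesgue Q0 (u n)" and v: "set_integrable lebesgue Q0 v"
    and lim: "(\<lambda>n. LINT x:Q0|lebesgue. \<bar>u n x - v x\<bar>) \<longlonglongrightarrow> 0"
    and bound: "\<forall>\<^sub>F n in sequentially. JNd_sup p Q0 (u n) \<le> ennreal b"
  shows "JNd_sup p Q0 v \<le> ennreal b"
proof (subst JNd_sup_le_iff[OF assms(2)]; intro ballI impI)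
  fix F assume F: "F \<in> dyadic_collections Q0" "finite F"
  have "(\<lambda>n. osc Q (u n)) \<longlonglongrightarrow> osc Q v" if "Q \<in> F" for Q
  proof -
    have Q: "Q \<in> dyadic Q0"
      using F that by (auto simp: dyadic_collections_def)
    have abs: "set_integrable lebesgue Q0 (\<lambda>x. \<bar>u n x - v x\<bar>)" for n
      by (intro set_integrable_abs set_integral_diff u v)
    have "(LINT x:Q|lebesgue. \<bar>u n x - v x\<bar>) \<le> (LINT x:Q0|lebesgue. \<bar>u n x - v x\<bar>)" for n
      using abs[of n] set_integrable_dyadic[OF abs[of n] Q] dyadicE(3)[OF Q]
      unfolding set_lebesgue_integral_def set_integrable_def
      by (intro integral_mono) (auto simp: indicator_def)
    moreover have "0 \<le> (LINT x:Q|lebesgue. \<bar>u n x - v x\<bar>)" for n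
      unfolding set_lebesgue_integral_def by (intro Bochner_Integration.integral_nonneg) simp
    ultimately have "(\<lambda>n. LINT x:Q|lebesgue. \<bar>u n x - v x\<bar>) \<longlonglongrightarrow> 0"
      by (intro tendsto_sandwich[OF _ _ tendsto_const lim]) auto
    then have "(\<lambda>n. average Q (\<lambda>x. \<bar>u n x - v x\<bar>)) \<longlonglongrightarrow> 0"
      unfolding average_def by (rule tendsto_mult_right_zero)
    then show ?thesis
      by (intro tendsto_osc dyadicE[OF Q] set_integrable_dyadic[OF _ Q] u v)
  qed
  \<comment> \<open>Oscillations may tend to 0; the power is continuous there because the base is
    nonnegative and p > 0.\<close>
  then have "(\<lambda>n. \<Sum>Q\<in>F. measure lebesgue Q * osc Q (u n) powr p)
      \<longlonglongrightarrow> (\<Sum>Q\<in>F. measure lebesgue Q * osc Q v powr p)"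
    using assms(1) by (intro tendsto_sum tendsto_mult tendsto_const tendsto_powr') (auto simp: osc_nonneg)
  moreover have "\<forall>\<^sub>F n in sequentially. (\<Sum>Q\<in>F. measure lebesgue Q * osc Q (u n) powr p) \<le> b"
    using bound by eventually_elim (use F assms(2) in \<open>auto simp: JNd_sup_le_iff\<close>)
  ultimately show "(\<Sum>Q\<in>F. measure lebesgue Q * osc Q v powr p) \<le> b"
    by (rule tendsto_upperbound[OF _ _ sequentially_bot])
qed

text \<open>Each term of the sums ignores constants. This undoes the normalisation of the sequence
  inside the seminorm.\<close>

lemma JNd_sup_diff_const:
  assumes "set_integrable lebesgue Q0 u"
  shows "JNd_sup p Q0 (\<lambda>x. u x - c) = JNd_sup p Q0 u"
proof -
  have "osc Q (\<lambda>x. u x - c) = osc Q u" if "Q \<in> dyadic Q0" for Q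
    by (intro osc_diff_const dyadicE[OF that] set_integrable_dyadic[OF assms that])
  then show ?thesis
    unfolding JNd_sup_def osc_def[symmetric]
    by (intro SUP_cong refl infsum_cong) (auto simp: dyadic_collections_def subset_eq)
qed

section \<open>Completeness of the dyadic John-Nirenberg space\<close>

theorem theorem5p1:
  fixes p :: real and Q0 :: "(real ^ 'n) set" and f :: "nat \<Rightarrow> real ^ 'n \<Rightarrow> real"
  assumes "1 < p"
    and "is_cube Q0"
    and "\<And>j. f j \<in> JNd p Q0"
    and "\<And>\<epsilon>::real. \<epsilon> > 0 \<Longrightarrow>
           \<exists>N. \<forall>i\<ge>N. \<forall>j\<ge>N. JNd_norm p Q0 (\<lambda>x. f i x - f j x) < ennreal \<epsilon>"
  shows "\<exists>g \<in> JNd p Q0. (\<lambda>j. JNd_norm p Q0 (\<lambda>x. g x - f j x)) \<longlonglongrightarrow> 0"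
proof -
  note Q0 = dyadicE(1,2)[OF cube_in_dyadic[OF assms(2)]]
  let ?m = "measure lebesgue Q0"
  have p: "p > 0"
    using assms(1) by simp
  have f: "set_integrable lebesgue Q0 (f j)" for j
    using assms(3) by (auto simp: JNd_def)
  \<comment> \<open>The seminorm does not control averages, so the \<open>f j\<close> themselves may
    diverge in L1.\<close>
  define h where "h j x = f j x - average Q0 (f j)" for j x
  have h: "set_integrable lebesgue Q0 (h j)" for j
    unfolding h_def by (intro set_integral_diff f set_integrable_const_lmeasurable Q0)
  \<comment> \<open>The difference of \<open>h i\<close> and \<open>h j\<close> is
    \<open>f i - f j\<close> minus its own average over \<open>Q0\<close>.\<close>
  have h_osc: "(LINT x:Q0|lebesgue. \<bar>h i x - h j x\<bar>) = ?m * osc Q0 (\<lambda>x. f i x - f j x)" for i j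
    using Q0 by (simp add: osc_def average_diff[OF f f] average_def[of _ "\<lambda>x. \<bar>_ x\<bar>"] h_def algebra_simps)
  have sup: "\<exists>N. \<forall>i\<ge>N. \<forall>j\<ge>N. JNd_sup p Q0 (\<lambda>x. f i x - f j x) \<le> ennreal (e powr p)" if "e > 0" for e
    using assms(4)[OF that] JNd_sup_le_of_norm_le[OF p, of e Q0] that by (meson less_imp_le)
  have "\<exists>N. \<forall>i\<ge>N. \<forall>j\<ge>N. (LINT x:Q0|lebesgue. \<bar>h i x - h j x\<bar>) < e" if "e > 0" for e
  proof -
    \<comment> \<open>Chosen so that \<open>?m * b\<close> equals e/2, strictly below e.\<close>
    define b where "b = e / (2 * ?m)"
    have b: "b > 0"
      using that Q0 by (simp add: b_def)
    \<comment> \<open>The Cauchy condition is applied with tolerance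
      \<open>?m powr (1 / p) * b\<close>, whose p-th power is the bound needed to test with the
      single cube \<open>Q0\<close>.\<close>
    have "(?m powr (1 / p) * b) powr p = ?m * b powr p"
      using p Q0 b by (simp add: powr_mult powr_powr)
    then obtain N where N: "\<forall>i\<ge>N. \<forall>j\<ge>N. JNd_sup p Q0 (\<lambda>x. f i x - f j x) \<le> ennreal (?m * b powr p)"
      using sup[of "?m powr (1 / p) * b"] b Q0 by auto
    have "(LINT x:Q0|lebesgue. \<bar>h i x - h j x\<bar>) < e" if "i \<ge> N" "j \<ge> N" for i j
    proof -
      have "osc Q0 (\<lambda>x. f i x - f j x) \<le> b"
        using N that b by (intro osc_le_of_JNd_sup_le[OF p _ assms(2)]) auto
      then have "?m * osc Q0 (\<lambda>x. f i x - f j x) \<le> ?m * b"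
        using Q0 by (intro mult_left_mono) auto
      also have "\<dots> < e"
        using Q0 \<open>e > 0\<close> by (simp add: b_def)
      finally show ?thesis
        by (simp add: h_osc)
    qed
    then show ?thesis by blast
  qed
  then obtain g where g: "set_integrable lebesgue Q0 g"
    and lim: "(\<lambda>n. LINT x:Q0|lebesgue. \<bar>h n x - g x\<bar>) \<longlonglongrightarrow> 0"
    using set_L1_complete[of Q0 lebesgue h] h Q0(1) by blast
  have bound: "\<exists>N. \<forall>j\<ge>N. JNd_sup p Q0 (\<lambda>x. g x - f j x) \<le> ennreal (e powr p)" if "e > 0" for e
  proof -
    obtain N where N: "\<forall>i\<ge>N. \<forall>j\<ge>N. JNd_sup p Q0 (\<lambda>x. f i x - f j x) \<le> ennreal (e powr p)"
      using sup[OF \<open>e > 0\<close>] by blast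
    have "JNd_sup p Q0 (\<lambda>x. g x - f j x) \<le> ennreal (e powr p)" if "j \<ge> N" for j
    \<comment> \<open>With j fixed, \<open>f j\<close> cancels in the difference to
      \<open>g - f j\<close>, so the L1 convergence of \<open>h n\<close> to \<open>g\<close>
      applies directly.\<close>
    proof (rule JNd_sup_le_of_L1_limit[where u = "\<lambda>n x. h n x - f j x"])
      have "(\<lambda>x. h n x - f j x) = (\<lambda>x. (f n x - f j x) - average Q0 (f n))" for n
        by (simp add: h_def algebra_simps)
      then have "JNd_sup p Q0 (\<lambda>x. h n x - f j x) = JNd_sup p Q0 (\<lambda>x. f n x - f j x)" for n
        using JNd_sup_diff_const[OF set_integral_diff(1)[OF f f]] by simp
      then show "\<forall>\<^sub>F n in sequentially. JNd_sup p Q0 (\<lambda>x. h n x - f j x) \<le> ennreal (e powr p)"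
        using N that by (intro eventually_sequentiallyI[of N]) simp
    qed (use p h f g lim in auto)
    then show ?thesis by blast
  qed
  \<comment> \<open>Any fixed tolerance, here 1, puts \<open>g - f N\<close> into the space; adding
    \<open>f N\<close> then gives membership of \<open>g\<close>.\<close>
  obtain N where "JNd_sup p Q0 (\<lambda>x. g x - f N x) \<le> ennreal (1 powr p)"
    using bound[of 1] by auto
  then have "JNd_norm p Q0 (\<lambda>x. g x - f N x) < \<infinity>"
    unfolding JNd_norm_finite_iff by (intro exI[of _ "1 powr p"]) simp
  then have "(\<lambda>x. g x - f N x) \<in> JNd p Q0"
    using f g by (auto simp: JNd_def)
  from JNd_add[OF _ this assms(3)[of N]] have "g \<in> JNd p Q0"
    using p by simp
  moreover have "(\<lambda>j. JNd_norm p Q0 (\<lambda>x. g x - f j x)) \<longlonglongrightarrow> 0"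
  proof (rule order_tendstoI)
    fix a :: ennreal assume "0 < a"
    \<comment> \<open>The bound \<open>a\<close> may be infinite. A value strictly between 0 and
      \<open>a\<close> is finite, hence a real tolerance, and leaves room for strictness.\<close>
    then obtain b where b: "0 < b" "b < a"
      using dense by blast
    then have "b < top"
      using less_le_trans[OF b(2) top_greatest] by simp
    with b have e: "0 < enn2real b" "ennreal (enn2real b) = b"
      by (auto simp: enn2real_positive_iff)
    then obtain N where "\<forall>j\<ge>N. JNd_sup p Q0 (\<lambda>x. g x - f j x) \<le> ennreal (enn2real b powr p)"
      using bound by blast
    then have "\<forall>j\<ge>N. JNd_norm p Q0 (\<lambda>x. g x - f j x) \<le> b"
      using JNd_norm_le_of_sup_le[OF p less_imp_le[OF e(1)]] e(2) by metis
    then show "\<forall>\<^sub>F j in sequentially. JNd_norm p Q0 (\<lambda>x. g x - f j x) < a"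
      using b(2) by (intro eventually_sequentiallyI[of N]) (auto intro: le_less_trans)
  qed simp
  ultimately show ?thesis by blast
qed

end
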